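(* Let $\lambda$ be a partition. For any $k\ge\mathrm{len}(\lambda)$ and any $n$, the polynomial $p_n^{(k,\lambda)}(x)=\mathbb E\big[m_k^{(\lambda)}(L_{k,n}x)\big]$, $x\in\mathbb R^n$, is given by $$p_n^{(k,\lambda)}(x)=\sum_{\mu\le_R\lambda}\frac{\lambda!}{\mu!}\cdot\frac{(k)_{\mathrm{len}(\lambda)}}{k^{\mathrm{len}(\mu)}}\cdot\frac{R_{\mu,\lambda}}{R_{\lambda,\lambda}}\cdot m_n^{(\mu)}(x),$$ where $(k)_\ell=\frac{k!}{(k-\ell)!}$ and $\lambda!=\prod_{i=1}^{\mathrm{len}(\lambda)}\lambda_i!$.
   Context: Here $k,n$ are positive integers and $[n]=\{1,\dots,n\}$. A partition is a finite sequence $\lambda=(\lambda_1\ge\dots\ge\lambda_{\mathrm{len}(\lambda)}>0)$ of positive integers, with length $\mathrm{len}(\lambda)$. For $k\ge\mathrm{len}(\lambda)$, view $\lambda\in\mathbb N^k$ by zero-padding; the symmetric group $\mathfrak S_k$ acts by permuting coordinates, and the monomial sum is $m_k^{(\lambda)}(x)=\sum_{\lambda'\in\mathfrak S_k\lambda}x^{\lambda'}$ for $x\in\mathbb R^k$, where $\mathfrak S_k\lambda$ is the orbit (a set of distinct exponents) and $x^{\lambda'}=\prod_ix_i^{\lambda'_i}$. For $n<\mathrm{len}(\mu)$, $m_n^{(\mu)}=0$. The random map $L_{k,n}:\mathbb R^n\to\mathbb R^k$ is $(L_{k,n}x)_i=\sum_{j\in F_{k,n}^{-1}(i)}x_j$,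 $i\in[k]$, where $F_{k,n}:[n]\to[k]$ is a uniformly random map. For partitions $\mu,\lambda$, write $\mu\le_R\lambda$ ($\mu$ is a refinement of $\lambda$) if there is a surjection $f:[\mathrm{len}(\mu)]\to[\mathrm{len}(\lambda)]$ with $\sum_{j\in f^{-1}(i)}\mu_j=\lambda_i$ for each $i\in[\mathrm{len}(\lambda)]$; $R_{\mu,\lambda}$ is the number of such surjections. *)

theory Defs
  imports "HOL-Probability.Probability" "HOL-Combinatorics.Combinatorics"
begin

text \<open>
  The set \<open>[n]\<close> is \<open>{1..n}\<close>. A vector of length \<open>n\<close> is a function on \<^typ>\<open>nat\<close> of which only
  the values on \<open>{1..n}\<close> are used. Lists are indexed from 0, partitions and vectors from 1.
\<close>

definition is_partition :: "nat list \<Rightarrow> bool" where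
  "is_partition la \<longleftrightarrow> sorted_wrt (\<ge>) la \<and> (\<forall>a\<in>set la. 0 < a)"

definition zero_pad :: "nat list \<Rightarrow> nat \<Rightarrow> nat" where
  "zero_pad la i = (if i \<in> {1..length la} then la ! (i - 1) else 0)"

definition orbit :: "nat \<Rightarrow> nat list \<Rightarrow> (nat \<Rightarrow> nat) set" where
  "orbit k la = {zero_pad la \<circ> \<sigma> | \<sigma>. \<sigma> permutes {1..k}}"

definition monomial :: "nat \<Rightarrow> (nat \<Rightarrow> nat) \<Rightarrow> (nat \<Rightarrow> real) \<Rightarrow> real" where
  "monomial k a x = (\<Prod>i\<in>{1..k}. x i ^ a i)"

definition monomial_sum :: "nat \<Rightarrow> nat list \<Rightarrow> (nat \<Rightarrow> real) \<Rightarrow> real" where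
  "monomial_sum k la x = (if length la \<le> k then \<Sum>a\<in>orbit k la. monomial k a x else 0)"

definition random_map :: "nat \<Rightarrow> nat \<Rightarrow> (nat \<Rightarrow> nat) pmf" where
  "random_map k n = pmf_of_set ({1..n} \<rightarrow>\<^sub>E {1..k})"

text \<open>The linear map \<open>L\<close> attached to a realization \<open>F\<close> of the random map.\<close>

definition pushforward :: "nat \<Rightarrow> (nat \<Rightarrow> nat) \<Rightarrow> (nat \<Rightarrow> real) \<Rightarrow> nat \<Rightarrow> real" where
  "pushforward n F x i = (\<Sum>j\<in>{j\<in>{1..n}. F j = i}. x j)"

definition expected_poly :: "nat \<Rightarrow> nat \<Rightarrow> nat list \<Rightarrow> (nat \<Rightarrow> real) \<Rightarrow> real" where
  "expected_poly n k la x =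
     measure_pmf.expectation (random_map k n) (\<lambda>F. monomial_sum k la (pushforward n F x))"

definition refinement_maps :: "nat list \<Rightarrow> nat list \<Rightarrow> (nat \<Rightarrow> nat) set" where
  "refinement_maps mu la =
     {f \<in> {1..length mu} \<rightarrow>\<^sub>E {1..length la}.
        f ` {1..length mu} = {1..length la} \<and>
        (\<forall>i\<in>{1..length la}. (\<Sum>j\<in>{j\<in>{1..length mu}. f j = i}. mu ! (j - 1)) = la ! (i - 1))}"

definition refines :: "nat list \<Rightarrow> nat list \<Rightarrow> bool" (infix "\<le>\<^sub>R" 50) where
  "mu \<le>\<^sub>R la \<longleftrightarrow> (\<exists>f. f \<in> refinement_maps mu la)"

definition refinement_count :: "nat list \<Rightarrow> nat list \<Rightarrow> nat" where
  "refinement_count mu la = card (refinement_maps mu la)"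

definition falling_fact :: "nat \<Rightarrow> nat \<Rightarrow> real" where
  "falling_fact k l = fact k / fact (k - l)"

definition partition_fact :: "nat list \<Rightarrow> real" where
  "partition_fact la = (\<Prod>i<length la. fact (la ! i))"

lemma refines_sum_list:
  assumes "mu \<le>\<^sub>R la"
  shows "sum_list mu = sum_list la"
proof -
  obtain f where "f \<in> refinement_maps mu la"
    using assms by (auto simp: refines_def)
  then have im: "f ` {1..length mu} = {1..length la}"
    and s: "\<And>i. i \<in> {1..length la} \<Longrightarrow>
      (\<Sum>j\<in>{j\<in>{1..length mu}. f j = i}. mu ! (j - 1)) = la ! (i - 1)"
    by (auto simp: refinement_maps_def)
  have sl: "sum_list xs = (\<Sum>j\<in>{1..length xs}. xs ! (j - 1))" for xs :: "nat list"
    unfolding sum_list_sum_nth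
    by (rule sum.reindex_bij_witness[of _ "\<lambda>j. j - 1" Suc]) auto
  have "sum_list mu = (\<Sum>i\<in>{1..length la}. \<Sum>j\<in>{j\<in>{1..length mu}. f j = i}. mu ! (j - 1))"
    unfolding sl by (rule sum.group[symmetric]) (use im in auto)
  also have "\<dots> = sum_list la"
    unfolding sl by (rule sum.cong) (use s in auto)
  finally show ?thesis .
qed

text \<open>A sum over the refinements of \<open>la\<close> is a genuine finite sum.\<close>

lemma finite_refinements: "finite {mu. is_partition mu \<and> mu \<le>\<^sub>R la}"
proof (rule finite_subset)
  show "finite {mu. set mu \<subseteq> {..sum_list la} \<and> length mu \<le> sum_list la}"
    by (rule finite_lists_length_le) simp
  have len: "length mu \<le> sum_list mu" if "\<forall>a\<in>set mu. 0 < a" for mu :: "nat list"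
    using that by (induction mu) auto
  show "{mu. is_partition mu \<and> mu \<le>\<^sub>R la}
      \<subseteq> {mu. set mu \<subseteq> {..sum_list la} \<and> length mu \<le> sum_list la}"
  proof
    fix mu assume "mu \<in> {mu. is_partition mu \<and> mu \<le>\<^sub>R la}"
    then have pos: "\<forall>a\<in>set mu. 0 < a" and eq: "sum_list mu = sum_list la"
      by (simp_all add: is_partition_def refines_sum_list)
    have "length mu \<le> sum_list la"
      using len[OF pos] eq by simp
    moreover have "set mu \<subseteq> {..sum_list la}"
      using member_le_sum_list[of _ mu] eq by auto
    ultimately show "mu \<in> {mu. set mu \<subseteq> {..sum_list la} \<and> length mu \<le> sum_list la}"
      by simp
  qed
qed

end

theory Submission
  imports Defs
begin

text \<open>
  For a fixed map \<open>F\<close>, the multinomial theorem expands \<open>(L x)\<^sup>a\<close> as the sum of \<open>a! / b! x\<^sup>b\<close> over the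
  exponents \<open>b\<close> on \<open>[n]\<close> whose fibre sums along \<open>F\<close> are given by \<open>a\<close>. Exchanging the sums, the
  coefficient of \<open>x\<^sup>b\<close>, for \<open>b\<close> in the orbit of \<open>mu\<close>, is \<open>la! / mu!\<close> times the probability that \<open>F\<close> sends
  \<open>b\<close> into the orbit of \<open>la\<close>. By symmetry the number of maps sending \<open>b\<close> to \<open>a\<close> does not depend on the
  choice of \<open>b\<close> and \<open>a\<close> in their orbits: it is \<open>k\<^bsup>n - len mu\<^esup> R(mu, la)\<close>, since the zeros of \<open>b\<close> go
  anywhere and positivity forces the parts of \<open>mu\<close> onto the support of \<open>a\<close>. Applied to \<open>mu = la\<close>, the same
  count shows that the orbit of \<open>la\<close> has \<open>(k)\<^bsub>len la\<^esub> / R(la, la)\<close> elements.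
\<close>

section \<open>Multinomial expansion along a map\<close>

definition weight :: "'a set \<Rightarrow> ('a \<Rightarrow> 'b) \<Rightarrow> ('a \<Rightarrow> nat) \<Rightarrow> 'b \<Rightarrow> nat" where
  "weight S F b i = (\<Sum>j | j \<in> S \<and> F j = i. b j)"

text \<open>\<open>lifts\<close> and \<open>fiber_maps\<close> are two slices of one relation
  between \<open>F\<close>, \<open>b\<close> and \<open>a\<close>: the first varies the exponent
  \<open>b\<close> for a fixed map, the second varies the map for a fixed exponent. Vanishing off
  \<open>S\<close> gives each exponent on \<open>S\<close> a single representative.\<close>

definition lifts :: "'a set \<Rightarrow> 'b set \<Rightarrow> ('a \<Rightarrow> 'b) \<Rightarrow> ('b \<Rightarrow> nat) \<Rightarrow> ('a \<Rightarrow> nat) set" where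
  "lifts S T F a = {b. (\<forall>j. j \<notin> S \<longrightarrow> b j = 0) \<and> (\<forall>i\<in>T. weight S F b i = a i)}"

definition fiber_maps :: "'a set \<Rightarrow> 'b set \<Rightarrow> ('a \<Rightarrow> nat) \<Rightarrow> ('b \<Rightarrow> nat) \<Rightarrow> ('a \<Rightarrow> 'b) set" where
  "fiber_maps S T b a = {F \<in> S \<rightarrow>\<^sub>E T. \<forall>i\<in>T. weight S F b i = a i}"

lemma weight_insert:
  assumes "finite S" "s \<notin> S"
  shows "weight (insert s S) F b i = (if F s = i then b s else 0) + weight S F b i"
proof (cases "F s = i")
  case True
  then have "{j. j \<in> insert s S \<and> F j = i} = insert s {j. j \<in> S \<and> F j = i}"
    by auto
  with True show ?thesis
    unfolding weight_def using assms by simp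
next
  case False
  then have "{j. j \<in> insert s S \<and> F j = i} = {j. j \<in> S \<and> F j = i}"
    by auto
  with False show ?thesis
    unfolding weight_def by simp
qed

lemma weight_fun_upd [simp]:
  "s \<notin> S \<Longrightarrow> weight S F (b(s := c)) i = weight S F b i"
  "s \<notin> S \<Longrightarrow> weight S (F(s := t)) b i = weight S F b i"
  unfolding weight_def by (rule sum.cong; auto)+

text \<open>Since \<open>F\<close> lands in \<open>T\<close>, each entry \<open>b j\<close> lies in
  a fibre of prescribed weight \<open>a (F j)\<close> and is therefore at most
  \<open>sum a T\<close>.\<close>

lemma finite_lifts:
  assumes "finite S" "finite T" "F \<in> S \<rightarrow> T"
  shows "finite (lifts S T F a)"
proof (rule finite_subset)
  show "finite {b. \<forall>j. (j \<in> S \<longrightarrow> b j \<in> {..sum a T}) \<and> (j \<notin> S \<longrightarrow> b j = 0)}"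
    by (rule finite_set_of_finite_funs) (use assms in auto)
  have "b j \<le> sum a T" if b: "b \<in> lifts S T F a" and j: "j \<in> S" for b j
  proof -
    have "b j \<le> weight S F b (F j)"
      unfolding weight_def by (rule member_le_sum) (use assms j in auto)
    also have "\<dots> = a (F j)"
      using b j assms by (auto simp: lifts_def)
    also have "\<dots> \<le> sum a T"
      by (rule member_le_sum) (use assms j in auto)
    finally show ?thesis .
  qed
  then show "lifts S T F a \<subseteq> {b. \<forall>j. (j \<in> S \<longrightarrow> b j \<in> {..sum a T}) \<and> (j \<notin> S \<longrightarrow> b j = 0)}"
    by (auto simp: lifts_def)
qed

lemma binomial_divided_powers:
  fixes x y :: "'a :: field_char_0"
  shows "(x + y) ^ m / fact m = (\<Sum>c\<le>m. (x ^ c / fact c) * (y ^ (m - c) / fact (m - c)))"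
  unfolding binomial_ring sum_divide_distrib
  by (rule sum.cong) (auto simp: binomial_fact field_simps)

text \<open>Dividing powers by factorials makes all multinomial coefficients disappear. A new point
  \<open>s\<close> enters only the factor at \<open>F s\<close>; the binomial theorem splits off its
  exponent \<open>c\<close>, and the remaining exponents are lifts of \<open>a\<close> lowered by
  \<open>c\<close> at \<open>F s\<close>.\<close>

lemma multinomial_divided_powers:
  fixes x :: "'a \<Rightarrow> 'c :: field_char_0"
  assumes "finite S" "finite T" "F \<in> S \<rightarrow> T"
  shows "(\<Prod>i\<in>T. (\<Sum>j | j \<in> S \<and> F j = i. x j) ^ a i / fact (a i)) =
    (\<Sum>b\<in>lifts S T F a. \<Prod>j\<in>S. x j ^ b j / fact (b j))"
  using assms(1,3)
proof (induction S arbitrary: a rule: finite_induct)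
  case empty
  \<comment> \<open>All fibre sums are empty, so with 0^0 = 1 the product is 1 if \<open>a\<close>
    vanishes on \<open>T\<close> and 0 otherwise.\<close>
  show ?case
  proof (cases "\<forall>i\<in>T. a i = 0")
    case True
    then have "lifts {} T F a = {\<lambda>_. 0}"
      by (auto simp: lifts_def weight_def)
    with True show ?thesis by simp
  next
    case False
    then have "lifts {} T F a = {}"
      by (auto simp: lifts_def weight_def)
    moreover have "(\<Prod>i\<in>T. (0 :: 'c) ^ a i / fact (a i)) = 0"
      using False \<open>finite T\<close> by (auto simp: prod_zero_iff)
    ultimately show ?thesis by simp
  qed
next
  case (insert s S)
  let ?t = "F s" and ?X = "\<lambda>i. \<Sum>j | j \<in> S \<and> F j = i. x j"
  \<comment> \<open>The subtraction never truncates, because \<open>c\<close> only ranges up to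
    \<open>a ?t\<close>.\<close>
  let ?a = "\<lambda>c. a(?t := a ?t - c)"
  have t: "?t \<in> T" and FS: "F \<in> S \<rightarrow> T"
    using insert.prems by auto
  have X: "(\<Sum>j | j \<in> insert s S \<and> F j = i. x j) = (if i = ?t then x s + ?X i else ?X i)" for i
  proof (cases "i = ?t")
    case True
    then have "{j. j \<in> insert s S \<and> F j = i} = insert s {j. j \<in> S \<and> F j = i}"
      by auto
    with True show ?thesis using insert.hyps by simp
  next
    case False
    then have "{j. j \<in> insert s S \<and> F j = i} = {j. j \<in> S \<and> F j = i}"
      by auto
    with False show ?thesis by simp
  qed
  have "(\<Prod>i\<in>T. (\<Sum>j | j \<in> insert s S \<and> F j = i. x j) ^ a i / fact (a i)) =
      (x s + ?X ?t) ^ a ?t / fact (a ?t) * (\<Prod>i\<in>T - {?t}. ?X i ^ a i / fact (a i))"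
    unfolding X by (subst prod.remove[OF \<open>finite T\<close> t]) (auto intro!: prod.cong)
  also have "\<dots> = (\<Sum>c\<le>a ?t. (x s ^ c / fact c) * (\<Prod>i\<in>T. ?X i ^ ?a c i / fact (?a c i)))"
    unfolding binomial_divided_powers sum_distrib_right
  proof (rule sum.cong[OF refl])
    fix c
    have "(\<Prod>i\<in>T. ?X i ^ ?a c i / fact (?a c i)) =
        ?X ?t ^ (a ?t - c) / fact (a ?t - c) * (\<Prod>i\<in>T - {?t}. ?X i ^ a i / fact (a i))"
      by (subst prod.remove[OF \<open>finite T\<close> t]) (auto intro!: prod.cong)
    then show "x s ^ c / fact c * (?X ?t ^ (a ?t - c) / fact (a ?t - c)) *
        (\<Prod>i\<in>T - {?t}. ?X i ^ a i / fact (a i)) =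
        (x s ^ c / fact c) * (\<Prod>i\<in>T. ?X i ^ ?a c i / fact (?a c i))"
      by (simp add: mult.assoc)
  qed
  also have "\<dots> = (\<Sum>c\<le>a ?t. \<Sum>b\<in>lifts S T F (?a c).
      (x s ^ c / fact c) * (\<Prod>j\<in>S. x j ^ b j / fact (b j)))"
    by (simp only: insert.IH[OF FS] sum_distrib_left)
  also have "\<dots> = (\<Sum>(c, b)\<in>(SIGMA c:{..a ?t}. lifts S T F (?a c)).
      (x s ^ c / fact c) * (\<Prod>j\<in>S. x j ^ b j / fact (b j)))"
    by (rule sum.Sigma) (auto intro!: finite_lifts insert \<open>finite T\<close> FS)
  \<comment> \<open>A pair of an exponent \<open>c\<close> for \<open>s\<close> and a lift over
    \<open>S\<close> is the same as a lift over \<open>insert s S\<close>; lifts over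
    \<open>S\<close> have value 0 at \<open>s\<close>, which is the value to restore.\<close>
  also have "\<dots> = (\<Sum>b\<in>lifts (insert s S) T F a. \<Prod>j\<in>insert s S. x j ^ b j / fact (b j))"
  proof (rule sum.reindex_bij_witness[of _ "\<lambda>b. (b s, b(s := 0))" "\<lambda>(c, b). b(s := c)"],
      goal_cases)
    case (1 p)
    then show ?case using insert.hyps by (auto simp: lifts_def fun_eq_iff)
  next
    case (2 p)
    then show ?case
      using insert.hyps t by (auto simp: lifts_def weight_insert)
  next
    case (3 b)
    then show ?case by simp
  next
    case (4 b)
    then show ?case
      using insert.hyps t by (auto simp: lifts_def weight_insert split: if_splits)
  next
    case (5 p)
    obtain c b where p: "p = (c, b)" by force
    have "(\<Prod>j\<in>S. x j ^ (b(s := c)) j / fact ((b(s := c)) j)) = (\<Prod>j\<in>S. x j ^ b j / fact (b j))"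
      using insert.hyps by (auto intro!: prod.cong)
    then show ?case using insert.hyps p by simp
  qed
  finally show ?case .
qed

subsection \<open>Counting maps with prescribed fibre sums\<close>

lemma finite_fiber_maps: "finite S \<Longrightarrow> finite T \<Longrightarrow> finite (fiber_maps S T b a)"
  unfolding fiber_maps_def by (auto intro!: finite_PiE)

text \<open>Precomposition with \<sigma> is a bijection between the two sets. The auxiliary facts
  are stated for any permutation so that they also serve for the inverse.\<close>

lemma card_fiber_maps_permute_source:
  assumes "\<sigma> permutes S"
  shows "card (fiber_maps S T (b \<circ> \<sigma>) a) = card (fiber_maps S T b a)"
proof -
  have weight: "weight S (F \<circ> \<sigma>) (b \<circ> \<sigma>) i = weight S F b i"
    if \<sigma>: "\<sigma> permutes S" for \<sigma> :: "'a \<Rightarrow> 'a" and F :: "'a \<Rightarrow> 'b" and b :: "'a \<Rightarrow> nat" and i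
    unfolding weight_def
    by (rule sum.reindex_bij_witness[of _ "inv \<sigma>" \<sigma>])
      (auto simp: permutes_inverses[OF \<sigma>] permutes_in_image[OF \<sigma>]
        permutes_in_image[OF permutes_inv[OF \<sigma>]])
  have comp: "F \<circ> \<sigma> \<in> fiber_maps S T (b \<circ> \<sigma>) a"
    if \<sigma>: "\<sigma> permutes S" and F: "F \<in> fiber_maps S T b a"
    for \<sigma> :: "'a \<Rightarrow> 'a" and F and b :: "'a \<Rightarrow> nat"
    using F by (auto simp: fiber_maps_def weight[OF \<sigma>] PiE_def Pi_def extensional_def
        permutes_in_image[OF \<sigma>])
  have inv: "\<sigma> \<circ> inv \<sigma> = id" "inv \<sigma> \<circ> \<sigma> = id"
    using permutes_inv_o[OF assms] by auto
  have "bij_betw (\<lambda>F. F \<circ> \<sigma>) (fiber_maps S T b a) (fiber_maps S T (b \<circ> \<sigma>) a)"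
  proof (rule bij_betw_byWitness[where f' = "\<lambda>F. F \<circ> inv \<sigma>"])
    show "(\<lambda>F. F \<circ> inv \<sigma>) ` fiber_maps S T (b \<circ> \<sigma>) a \<subseteq> fiber_maps S T b a"
      using comp[OF permutes_inv[OF assms], of _ "b \<circ> \<sigma>"] by (auto simp: comp_assoc inv)
  qed (use comp[OF assms] in \<open>auto simp: comp_assoc inv\<close>)
  then show ?thesis
    by (simp add: bij_betw_same_card)
qed

text \<open>Postcomposition with the inverse of \<tau> relabels the fibres; \<open>restrict\<close>
  keeps the composite extensional on \<open>S\<close>.\<close>

lemma card_fiber_maps_permute_target:
  fixes S :: "'a set" and T :: "'b set"
  assumes "\<tau> permutes T"
  shows "card (fiber_maps S T b (a \<circ> \<tau>)) = card (fiber_maps S T b a)"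
proof -
  have comp: "restrict (inv \<tau> \<circ> F) S \<in> fiber_maps S T b (a \<circ> \<tau>)"
    if \<tau>: "\<tau> permutes T" and F: "F \<in> fiber_maps S T b a"
    for \<tau> :: "'b \<Rightarrow> 'b" and F and a :: "'b \<Rightarrow> nat"
  proof -
    have "weight S (restrict (inv \<tau> \<circ> F) S) b i = weight S F b (\<tau> i)" for i
    proof -
      have "{j. j \<in> S \<and> restrict (inv \<tau> \<circ> F) S j = i} = {j. j \<in> S \<and> F j = \<tau> i}"
        using permutes_inverses[OF \<tau>] by force
      then show ?thesis by (simp add: weight_def)
    qed
    then show ?thesis
      using F by (auto simp: fiber_maps_def permutes_in_image[OF \<tau>]
        permutes_in_image[OF permutes_inv[OF \<tau>]])
  qed
  have inv: "\<tau> \<circ> inv \<tau> = id" "inv \<tau> \<circ> \<tau> = id" "inv (inv \<tau>) = \<tau>"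
    using permutes_inv_o[OF assms] permutes_inv_inv[OF assms] by auto
  have "bij_betw (\<lambda>F. restrict (inv \<tau> \<circ> F) S) (fiber_maps S T b a) (fiber_maps S T b (a \<circ> \<tau>))"
  proof (rule bij_betw_byWitness[where f' = "\<lambda>F. restrict (\<tau> \<circ> F) S"])
    show "(\<lambda>F. restrict (\<tau> \<circ> F) S) ` fiber_maps S T b (a \<circ> \<tau>) \<subseteq> fiber_maps S T b a"
      using comp[OF permutes_inv[OF assms], of _ "a \<circ> \<tau>"] by (auto simp: comp_assoc inv)
    show "\<forall>F\<in>fiber_maps S T b a. restrict (\<tau> \<circ> restrict (inv \<tau> \<circ> F) S) S = F"
      by (auto simp: fiber_maps_def permutes_inverses[OF assms] fun_eq_iff PiE_def extensional_def)
    show "\<forall>F\<in>fiber_maps S T b (a \<circ> \<tau>). restrict (inv \<tau> \<circ> restrict (\<tau> \<circ> F) S) S = F"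
      by (auto simp: fiber_maps_def permutes_inverses[OF assms] fun_eq_iff PiE_def extensional_def)
  qed (use comp[OF assms] in auto)
  then show ?thesis
    by (simp add: bij_betw_same_card)
qed

text \<open>Points of \<open>Z\<close> add nothing to any fibre sum, so each of them may be sent to
  any element of \<open>T\<close>.\<close>

lemma card_fiber_maps_zero_source:
  assumes "finite Z" "finite S" "finite T" "S \<inter> Z = {}" "\<forall>j\<in>Z. b j = 0"
  shows "card (fiber_maps (S \<union> Z) T b a) = card T ^ card Z * card (fiber_maps S T b a)"
  using assms(1,4,5)
proof (induction Z rule: finite_induct)
  case (insert z Z)
  let ?A = "S \<union> Z"
  have z: "z \<notin> ?A" and fin: "finite ?A"
    using insert \<open>finite S\<close> by auto
  have "fiber_maps (insert z ?A) T b a = (\<lambda>(y, g). g(z := y)) ` (T \<times> fiber_maps ?A T b a)"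
  proof (intro equalityI subsetI)
    fix F assume F: "F \<in> fiber_maps (insert z ?A) T b a"
    \<comment> \<open>The value \<open>undefined\<close> at \<open>z\<close> is the default that
      extensional functions on \<open>?A\<close> must take there.\<close>
    have "F = (\<lambda>(y, g). g(z := y)) (F z, F(z := undefined))"
      by simp
    moreover have "F(z := undefined) \<in> fiber_maps ?A T b a" "F z \<in> T"
      using F z fin insert.prems
      by (auto simp: fiber_maps_def weight_insert PiE_def extensional_def split: if_splits)
    ultimately show "F \<in> (\<lambda>(y, g). g(z := y)) ` (T \<times> fiber_maps ?A T b a)"
      by (metis SigmaI image_eqI)
  qed (use z fin insert.prems in
      \<open>auto simp: fiber_maps_def weight_insert PiE_def extensional_def\<close>)
  moreover have "inj_on (\<lambda>(y, g). g(z := y)) (T \<times> fiber_maps ?A T b a)"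
    by (rule inj_on_subset[OF inj_combinator[OF z, of "\<lambda>_. T"]]) (auto simp: fiber_maps_def)
  ultimately have "card (fiber_maps (insert z ?A) T b a) = card T * card (fiber_maps ?A T b a)"
    by (simp add: card_image card_cartesian_product)
  then show ?case
    using insert by simp
qed simp

text \<open>As \<open>b\<close> is positive on \<open>S\<close>, every fibre that is hit has
  positive weight, so no point can be sent to a target where \<open>a\<close> vanishes.\<close>

lemma fiber_maps_zero_target:
  assumes "finite S" "T0 \<subseteq> T" "\<forall>i\<in>T - T0. a i = 0" "\<forall>j\<in>S. 0 < b j"
  shows "fiber_maps S T b a = fiber_maps S T0 b a"
proof -
  have pos: "0 < weight S F b (F j)" if "j \<in> S" for F :: "'a \<Rightarrow> 'b" and j
    unfolding weight_def by (rule sum_pos2[of _ j]) (use assms that in auto)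
  have "F j \<in> T0" if F: "F \<in> fiber_maps S T b a" and j: "j \<in> S" for F j
  proof (rule ccontr)
    assume "F j \<notin> T0"
    with F j assms(3) have "weight S F b (F j) = 0"
      by (auto simp: fiber_maps_def PiE_def Pi_def)
    with pos[OF j, of F] show False by simp
  qed
  moreover have "weight S F b i = 0" if "F \<in> S \<rightarrow> T0" "i \<in> T - T0" for F i
    using that unfolding weight_def by (auto intro!: sum.neutral)
  ultimately show ?thesis
    using assms(2,3)
    by (intro set_eqI) (auto simp: fiber_maps_def PiE_iff; metis DiffI)
qed

subsection \<open>Orbits of partitions\<close>

text \<open>The number of zeros is forced by the size of \<open>A\<close>; hence the positive values
  alone determine the multiset of all values.\<close>

lemma image_mset_positive_part:
  fixes b :: "'a \<Rightarrow> nat"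
  assumes "finite A"
  defines "M \<equiv> image_mset b (mset_set {j\<in>A. 0 < b j})"
  shows "image_mset b (mset_set A) = M + replicate_mset (card A - size M) 0"
proof -
  let ?P = "{j\<in>A. 0 < b j}"
  have "mset_set A = mset_set ?P + mset_set (A - ?P)"
    using mset_set_Union[of ?P "A - ?P"] assms(1) by (simp add: Un_absorb1)
  moreover have "image_mset b (mset_set (A - ?P)) = image_mset (\<lambda>_. 0) (mset_set (A - ?P))"
    by (rule image_mset_cong) (use assms(1) in auto)
  moreover have "card (A - ?P) = card A - size M"
    using assms(1) by (simp add: M_def card_Diff_subset)
  ultimately show ?thesis
    by (simp add: M_def image_mset_const_eq)
qed

lemma zero_pad_pos: "\<forall>a\<in>set mu. 0 < a \<Longrightarrow> j \<in> {1..length mu} \<Longrightarrow> 0 < zero_pad mu j"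
  by (auto simp: zero_pad_def)

lemma positive_support_zero_pad:
  assumes "\<forall>a\<in>set mu. 0 < a" "length mu \<le> n"
  shows "{j\<in>{1..n}. 0 < zero_pad mu j} = {1..length mu}"
  using assms by (auto simp: zero_pad_def)

lemma image_mset_zero_pad: "image_mset (zero_pad mu) (mset_set {1..length mu}) = mset mu"
proof -
  have "mset_set {1..length mu} = image_mset Suc (mset_set {0..<length mu})"
    by (subst image_mset_mset_set) (auto simp: image_Suc_atLeastLessThan)
  moreover have "image_mset (zero_pad mu \<circ> Suc) (mset_set {0..<length mu}) =
      image_mset ((!) mu) (mset_set {0..<length mu})"
    by (rule image_mset_cong) (auto simp: zero_pad_def)
  moreover have "image_mset ((!) mu) (mset_set {0..<length mu}) = mset (map ((!) mu) [0..<length mu])"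
    by simp
  ultimately show ?thesis
    by (simp add: multiset.map_comp map_nth)
qed

text \<open>A description of orbits without permutations. For the converse, equal multisets of
  positive values give equal multisets of values on [n], and two functions with the same multiset of
  values differ by a permutation.\<close>

lemma in_orbit_iff:
  assumes "\<forall>a\<in>set mu. 0 < a" "length mu \<le> n"
  shows "b \<in> orbit n mu \<longleftrightarrow> (\<forall>j. j \<notin> {1..n} \<longrightarrow> b j = 0) \<and>
    image_mset b (mset_set {j\<in>{1..n}. 0 < b j}) = mset mu"
    (is "_ \<longleftrightarrow> ?supp b \<and> image_mset b (mset_set (?P b)) = mset mu")
proof safe
  fix j assume b: "b \<in> orbit n mu" and "j \<notin> {1..n}"
  then show "b j = 0"
    using assms by (auto simp: orbit_def zero_pad_def permutes_not_in)
next
  assume "b \<in> orbit n mu"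
  then obtain \<sigma> where \<sigma>: "\<sigma> permutes {1..n}" and b: "b = zero_pad mu \<circ> \<sigma>"
    by (auto simp: orbit_def)
  have "\<sigma> ` ?P b = ?P (zero_pad mu)"
  proof (intro equalityI subsetI)
    fix i assume "i \<in> ?P (zero_pad mu)"
    then have "inv \<sigma> i \<in> ?P b" "i = \<sigma> (inv \<sigma> i)"
      using permutes_in_image[OF permutes_inv[OF \<sigma>]] by (auto simp: b permutes_inverses[OF \<sigma>])
    then show "i \<in> \<sigma> ` ?P b" by blast
  qed (use permutes_in_image[OF \<sigma>] in \<open>auto simp: b\<close>)
  moreover have "inj_on \<sigma> (?P b)"
    using permutes_inj[OF \<sigma>] by (rule inj_on_subset) simp
  ultimately have "image_mset \<sigma> (mset_set (?P b)) = mset_set (?P (zero_pad mu))"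
    by (simp add: image_mset_mset_set)
  then have "image_mset b (mset_set (?P b)) = image_mset (zero_pad mu) (mset_set (?P (zero_pad mu)))"
    unfolding b by (metis multiset.map_comp)
  then show "image_mset b (mset_set (?P b)) = mset mu"
    by (simp only: positive_support_zero_pad[OF assms] image_mset_zero_pad)
next
  assume supp: "?supp b" and M: "image_mset b (mset_set (?P b)) = mset mu"
  have "image_mset b (mset_set {1..n}) = image_mset (zero_pad mu) (mset_set {1..n})"
    using image_mset_positive_part[of "{1..n}" b] image_mset_positive_part[of "{1..n}" "zero_pad mu"] M
    by (simp only: positive_support_zero_pad[OF assms] image_mset_zero_pad finite_atLeastAtMost)
  then obtain \<sigma> where \<sigma>: "\<sigma> permutes {1..n}" and *: "\<forall>j\<in>{1..n}. b j = zero_pad mu (\<sigma> j)"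
    using image_mset_eq_implies_permutes[of "{1..n}" b "zero_pad mu"] by auto
  have "b j = zero_pad mu (\<sigma> j)" for j
  proof (cases "j \<in> {1..n}")
    case False
    then have "\<sigma> j = j" using \<sigma> by (simp add: permutes_not_in)
    with False supp assms show ?thesis by (auto simp: zero_pad_def)
  qed (use * in auto)
  then show "b \<in> orbit n mu"
    using \<sigma> by (auto simp: orbit_def fun_eq_iff)
qed

lemma zero_pad_in_orbit: "zero_pad mu \<in> orbit n mu"
  unfolding orbit_def by (auto intro!: exI[of _ id] permutes_id)

lemma finite_orbit: "finite (orbit n mu)"
proof -
  have "orbit n mu = (\<lambda>\<sigma>. zero_pad mu \<circ> \<sigma>) ` {\<sigma>. \<sigma> permutes {1..n}}"
    by (auto simp: orbit_def)
  then show ?thesis by (simp add: finite_permutations)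
qed

text \<open>The positive values of \<open>b\<close>, sorted in descending order, recover the
  partition. Together with \<open>orbit_exists\<close>, the orbits of partitions of length at most
  \<open>n\<close> split the exponents supported on [n] into disjoint classes.\<close>

lemma orbit_unique:
  assumes "is_partition mu" "is_partition nu" "length mu \<le> n" "length nu \<le> n"
    and "b \<in> orbit n mu" "b \<in> orbit n nu"
  shows "mu = nu"
proof -
  have "mset mu = mset nu"
    using assms in_orbit_iff[of mu n b] in_orbit_iff[of nu n b] by (simp add: is_partition_def)
  then have "mset (rev mu) = mset (rev nu)" by simp
  moreover have "sorted (rev mu)" "sorted (rev nu)"
    using assms by (simp_all add: is_partition_def sorted_wrt_rev)
  ultimately show ?thesis
    by (metis properties_for_sort rev_rev_ident)
qed

lemma orbit_exists:
  assumes "\<forall>j. j \<notin> {1..n} \<longrightarrow> b j = 0"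
  obtains mu where "is_partition mu" "length mu \<le> n" "b \<in> orbit n mu"
proof -
  define M where "M = image_mset b (mset_set {j\<in>{1..n}. 0 < b j})"
  define mu where "mu = rev (sorted_list_of_multiset M)"
  have mset: "mset mu = M"
    by (simp add: mu_def)
  have "set mu = set_mset M"
    by (simp flip: mset)
  then have pos: "\<forall>a\<in>set mu. 0 < a"
    by (auto simp: M_def)
  have "sorted_wrt (\<ge>) mu"
    using sorted_sorted_list_of_multiset[of M] by (simp add: mu_def sorted_wrt_rev)
  moreover have "length mu \<le> n"
  proof -
    have "length mu = card {j\<in>{1..n}. 0 < b j}"
      by (metis M_def mset size_image_mset size_mset size_mset_set)
    also have "\<dots> \<le> card {1..n}"
      by (rule card_mono) auto
    finally show ?thesis by simp
  qed
  ultimately show thesis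
    using that[of mu] pos assms in_orbit_iff[OF pos, of n b] mset
    by (simp add: is_partition_def M_def)
qed

text \<open>The product is invariant under permutations, and the padding contributes factors 0! =
  1.\<close>

lemma prod_fact_orbit:
  assumes "a \<in> orbit k la" "length la \<le> k"
  shows "(\<Prod>i\<in>{1..k}. fact (a i)) = partition_fact la"
proof -
  obtain \<sigma> where \<sigma>: "\<sigma> permutes {1..k}" and a: "a = zero_pad la \<circ> \<sigma>"
    using assms by (auto simp: orbit_def)
  have "(\<Prod>i\<in>{1..k}. fact (a i)) = (\<Prod>i\<in>{1..k}. fact (zero_pad la i) :: real)"
    using prod.permute[OF \<sigma>, of "\<lambda>i. fact (zero_pad la i) :: real"] by (simp add: a o_def)
  also have "\<dots> = (\<Prod>i\<in>{1..length la}. fact (zero_pad la i))"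
    by (rule prod.mono_neutral_right) (use assms in \<open>auto simp: zero_pad_def\<close>)
  also have "\<dots> = partition_fact la"
    unfolding partition_fact_def
    by (rule prod.reindex_bij_witness[of _ Suc "\<lambda>i. i - 1"]) (auto simp: zero_pad_def)
  finally show ?thesis .
qed

section \<open>Refinement counts and the size of an orbit\<close>

text \<open>Surjectivity comes for free: a fibre whose sum is a positive part of \<open>la\<close>
  cannot be empty.\<close>

lemma refinement_maps_eq_fiber_maps:
  assumes "\<forall>a\<in>set la. 0 < a"
  shows "refinement_maps mu la =
    fiber_maps {1..length mu} {1..length la} (zero_pad mu) (zero_pad la)"
proof -
  have weight: "weight {1..length mu} f (zero_pad mu) i =
      (\<Sum>j\<in>{j\<in>{1..length mu}. f j = i}. mu ! (j - 1))" for f :: "nat \<Rightarrow> nat" and i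
    unfolding weight_def by (rule sum.cong) (auto simp: zero_pad_def)
  have la: "zero_pad la i = la ! (i - 1)" "0 < la ! (i - 1)" if "i \<in> {1..length la}" for i
    using that assms by (auto simp: zero_pad_def)
  have "f ` {1..length mu} = {1..length la}"
    if f: "f \<in> {1..length mu} \<rightarrow>\<^sub>E {1..length la}"
      and eq: "\<forall>i\<in>{1..length la}. weight {1..length mu} f (zero_pad mu) i = la ! (i - 1)" for f
  proof
    show "{1..length la} \<subseteq> f ` {1..length mu}"
    proof
      fix i assume i: "i \<in> {1..length la}"
      then have "weight {1..length mu} f (zero_pad mu) i \<noteq> 0"
        using eq la by (metis less_irrefl)
      then have "{j. j \<in> {1..length mu} \<and> f j = i} \<noteq> {}"
        unfolding weight_def by (intro notI) (simp only: sum.empty)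
      then show "i \<in> f ` {1..length mu}" by blast
    qed
  qed (use f in auto)
  then show ?thesis
    unfolding refinement_maps_def fiber_maps_def weight[symmetric]
    by (auto simp: la(1) simp del: One_nat_def atLeastAtMost_iff)
qed

lemma card_fiber_maps_orbits:
  assumes "\<forall>a\<in>set mu. 0 < a" "\<forall>a\<in>set la. 0 < a" "length mu \<le> n" "length la \<le> k"
    and "b \<in> orbit n mu" "a \<in> orbit k la"
  shows "card (fiber_maps {1..n} {1..k} b a) = k ^ (n - length mu) * refinement_count mu la"
proof -
  obtain \<sigma> \<tau> where \<sigma>: "\<sigma> permutes {1..n}" "b = zero_pad mu \<circ> \<sigma>"
    and \<tau>: "\<tau> permutes {1..k}" "a = zero_pad la \<circ> \<tau>"
    using assms(5,6) by (auto simp: orbit_def)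
  let ?S = "{1..length mu}" and ?Z = "{length mu<..n}"
  have n: "{1..n} = ?S \<union> ?Z"
    using assms(3) by auto
  have "card (fiber_maps {1..n} {1..k} b a) =
      card (fiber_maps (?S \<union> ?Z) {1..k} (zero_pad mu) (zero_pad la))"
    using \<sigma> \<tau> n by (simp add: card_fiber_maps_permute_source card_fiber_maps_permute_target)
  also have "\<dots> = k ^ (n - length mu) * card (fiber_maps ?S {1..k} (zero_pad mu) (zero_pad la))"
    by (subst card_fiber_maps_zero_source) (auto simp: zero_pad_def)
  also have "fiber_maps ?S {1..k} (zero_pad mu) (zero_pad la) = refinement_maps mu la"
    unfolding refinement_maps_eq_fiber_maps[OF assms(2)]
    by (rule fiber_maps_zero_target) (use assms in \<open>auto simp: zero_pad_def\<close>)
  finally show ?thesis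
    by (simp add: refinement_count_def)
qed

text \<open>The support of the weight is the image of \<open>g\<close>. An element of the orbit has
  \<open>length la\<close> positive entries, so \<open>g\<close> cannot merge two parts; conversely,
  an injective \<open>g\<close> only moves the parts to new positions.\<close>

lemma weight_in_orbit_iff_inj_on:
  assumes "\<forall>a\<in>set la. 0 < a" "length la \<le> k" "g \<in> {1..length la} \<rightarrow> {1..k}"
  shows "weight {1..length la} g (zero_pad la) \<in> orbit k la \<longleftrightarrow> inj_on g {1..length la}"
proof -
  let ?S = "{1..length la}" and ?w = "weight {1..length la} g (zero_pad la)"
  have pos: "0 < ?w (g j)" if "j \<in> ?S" for j
    unfolding weight_def by (rule sum_pos2[of _ j]) (use zero_pad_pos[OF assms(1) that] that in simp_all)
  have zero: "?w i = 0" if "i \<notin> g ` ?S" for i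
    using that unfolding weight_def by (auto intro!: sum.neutral)
  have supp: "{i\<in>{1..k}. 0 < ?w i} = g ` ?S"
  proof (intro equalityI subsetI)
    fix i assume "i \<in> {i\<in>{1..k}. 0 < ?w i}"
    then show "i \<in> g ` ?S" using zero[of i] by force
  next
    fix i assume "i \<in> g ` ?S"
    then show "i \<in> {i\<in>{1..k}. 0 < ?w i}" using pos assms(3) by blast
  qed
  have "\<forall>i. i \<notin> {1..k} \<longrightarrow> ?w i = 0"
    by (intro allI impI zero) (use assms(3) in blast)
  then have iff: "?w \<in> orbit k la \<longleftrightarrow> image_mset ?w (mset_set (g ` ?S)) = mset la"
    unfolding in_orbit_iff[OF assms(1,2)] supp by blast
  show ?thesis
  proof
    assume "?w \<in> orbit k la"
    then have "size (image_mset ?w (mset_set (g ` ?S))) = length la"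
      by (simp only: iff size_mset)
    then show "inj_on g ?S"
      by (intro eq_card_imp_inj_on) auto
  next
    assume inj: "inj_on g ?S"
    have "?w (g j) = zero_pad la j" if "j \<in> ?S" for j
    proof -
      have "{j'. j' \<in> ?S \<and> g j' = g j} = {j}"
        using inj that by (auto dest: inj_onD)
      then show ?thesis by (simp add: weight_def)
    qed
    then have "image_mset (?w \<circ> g) (mset_set ?S) = image_mset (zero_pad la) (mset_set ?S)"
      by (intro image_mset_cong) auto
    then have "image_mset ?w (mset_set (g ` ?S)) = mset la"
      by (simp only: image_mset_zero_pad multiset.map_comp[symmetric] image_mset_mset_set[OF inj])
    then show "?w \<in> orbit k la" by (simp only: iff)
  qed
qed

lemma falling_fact_eq_prod:
  "l \<le> k \<Longrightarrow> falling_fact k l = (\<Prod>i<l. real (k - i))"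
proof (induction l)
  case (Suc l)
  have "fact (k - l) = real (k - l) * fact (k - Suc l)"
    using Suc.prems by (metis Suc_diff_Suc Suc_le_lessD fact_Suc of_nat_mult)
  moreover have "real (k - l) \<noteq> 0"
    using Suc.prems by simp
  ultimately have "falling_fact k (Suc l) = falling_fact k l * real (k - l)"
    unfolding falling_fact_def by (simp del: of_nat_diff)
  with Suc show ?case
    by simp
qed (simp add: falling_fact_def)

text \<open>Both sides count the injections \<open>[len la] \<rightarrow> [k]\<close>: these are the maps sending \<open>la\<close> into its orbit.\<close>

lemma card_orbit:
  assumes "\<forall>a\<in>set la. 0 < a" "length la \<le> k"
  shows "real (card (orbit k la)) * real (refinement_count la la) = falling_fact k (length la)"
proof -
  let ?S = "{1..length la}" and ?M = "fiber_maps {1..length la} {1..k} (zero_pad la)"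
  have out: "a i = 0" if "a \<in> orbit k la" "i \<notin> {1..k}" for a i
    using that in_orbit_iff[OF assms] by blast
  \<comment> \<open>\<open>fiber_maps\<close> constrains the weight on [k] only, but off [k] both
    sides vanish. The condition is thus an equality of functions, which makes the sets for different
    \<open>a\<close> disjoint.\<close>
  have M: "?M a = {g \<in> ?S \<rightarrow>\<^sub>E {1..k}. weight ?S g (zero_pad la) = a}" if a: "a \<in> orbit k la" for a
  proof -
    have "weight ?S g (zero_pad la) i = a i"
      if "g \<in> ?S \<rightarrow>\<^sub>E {1..k}" "i \<notin> {1..k}" for g i
      using that out[OF a that(2)] by (auto simp: weight_def)
    then show ?thesis
      by (force simp: fiber_maps_def fun_eq_iff)
  qed
  have "{g \<in> ?S \<rightarrow>\<^sub>E {1..k}. inj_on g ?S} = (\<Union>a\<in>orbit k la. ?M a)"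
    using weight_in_orbit_iff_inj_on[OF assms]
    by (auto simp: M PiE_iff simp del: One_nat_def)
  also have "card \<dots> = (\<Sum>a\<in>orbit k la. card (?M a))"
  proof (rule card_UN_disjoint)
    show "\<forall>a\<in>orbit k la. finite (?M a)"
      by (simp add: finite_fiber_maps)
  qed (auto simp: finite_orbit M simp del: One_nat_def)
  \<comment> \<open>Here the source is [n] with \<open>n = length la\<close>, so there are no free
    zeros and the power of \<open>k\<close> is 1.\<close>
  also have "\<dots> = card (orbit k la) * refinement_count la la"
    using card_fiber_maps_orbits[OF assms(1,1) order_refl assms(2) zero_pad_in_orbit] by simp
  finally have "card (orbit k la) * refinement_count la la = (\<Prod>i<length la. k - i)"
    using card_inj_on_subset_funcset[of ?S "{1..k}" ?S] by (simp add: lessThan_atLeast0)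
  then have "real (card (orbit k la) * refinement_count la la) = falling_fact k (length la)"
    using falling_fact_eq_prod[OF assms(2)] by simp
  then show ?thesis by simp
qed

subsection \<open>The expected polynomial\<close>

text \<open>The expectation is an average over k^n maps. Multiplying and dividing by the factorials
  of \<open>a\<close> produces divided powers, and the factor multiplied in is constant on the
  orbit.\<close>

lemma expected_poly_eq_sum_lifts:
  assumes "0 < k" "length la \<le> k"
  shows "expected_poly n k la x = partition_fact la / real k ^ n *
    (\<Sum>F\<in>{1..n} \<rightarrow>\<^sub>E {1..k}. \<Sum>a\<in>orbit k la.
      \<Sum>b\<in>lifts {1..n} {1..k} F a. \<Prod>j\<in>{1..n}. x j ^ b j / fact (b j))"
proof -
  let ?Fs = "{1..n} \<rightarrow>\<^sub>E {1..k}"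
  have mono: "monomial k a (pushforward n F x) = partition_fact la *
      (\<Sum>b\<in>lifts {1..n} {1..k} F a. \<Prod>j\<in>{1..n}. x j ^ b j / fact (b j))"
    if F: "F \<in> ?Fs" and a: "a \<in> orbit k la" for F a
  proof -
    have "monomial k a (pushforward n F x) =
        (\<Prod>i\<in>{1..k}. fact (a i)) * (\<Prod>i\<in>{1..k}. pushforward n F x i ^ a i / fact (a i))"
      by (simp add: monomial_def flip: prod.distrib)
    also have "(\<Prod>i\<in>{1..k}. pushforward n F x i ^ a i / fact (a i)) =
        (\<Sum>b\<in>lifts {1..n} {1..k} F a. \<Prod>j\<in>{1..n}. x j ^ b j / fact (b j))"
      unfolding pushforward_def by (rule multinomial_divided_powers) (use F in auto)
    finally show ?thesis
      by (simp only: prod_fact_orbit[OF a assms(2)])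
  qed
  have "finite ?Fs" by (auto intro: finite_PiE)
  moreover have "?Fs \<noteq> {}" using assms by (auto simp: PiE_eq_empty_iff)
  ultimately have "expected_poly n k la x =
      (\<Sum>F\<in>?Fs. monomial_sum k la (pushforward n F x)) / real (card ?Fs)"
    by (simp add: expected_poly_def random_map_def integral_pmf_of_set)
  also have "\<dots> = (\<Sum>F\<in>?Fs. \<Sum>a\<in>orbit k la. monomial k a (pushforward n F x)) / real k ^ n"
    using assms by (simp add: monomial_sum_def card_PiE)
  finally show ?thesis
    by (simp add: mono flip: sum_distrib_left)
qed

lemma monomial_sum_eq_divided_powers:
  assumes "length mu \<le> n"
  shows "(\<Sum>b\<in>orbit n mu. \<Prod>j\<in>{1..n}. x j ^ b j / fact (b j)) = monomial_sum n mu x / partition_fact mu"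
proof -
  have "(\<Sum>b\<in>orbit n mu. \<Prod>j\<in>{1..n}. x j ^ b j / fact (b j)) =
      (\<Sum>b\<in>orbit n mu. monomial n b x / partition_fact mu)"
    by (intro sum.cong refl) (simp only: monomial_def prod_dividef prod_fact_orbit[OF _ assms])
  then show ?thesis
    using assms by (simp add: monomial_sum_def flip: sum_divide_distrib)
qed

text \<open>The map \<open>F\<close> itself witnesses that \<open>fiber_maps\<close> is nonempty for
  \<open>b\<close> and \<open>a\<close>; by the orbit count, the refinement count for the partition
  of \<open>b\<close> is then nonzero.\<close>

lemma lifts_refine:
  assumes "\<forall>a\<in>set la. 0 < a" "length la \<le> k"
    and "F \<in> {1..n} \<rightarrow>\<^sub>E {1..k}" "a \<in> orbit k la" "b \<in> lifts {1..n} {1..k} F a"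
  obtains mu where "is_partition mu" "mu \<le>\<^sub>R la" "length mu \<le> n" "b \<in> orbit n mu"
proof -
  obtain mu where mu: "is_partition mu" "length mu \<le> n" "b \<in> orbit n mu"
    using assms(5) orbit_exists[of n b] by (auto simp: lifts_def)
  have "F \<in> fiber_maps {1..n} {1..k} b a"
    using assms by (auto simp: fiber_maps_def lifts_def)
  then have "card (fiber_maps {1..n} {1..k} b a) \<noteq> 0"
    using finite_fiber_maps[of "{1..n}" "{1..k}"] by auto
  then have "refinement_count mu la \<noteq> 0"
    using card_fiber_maps_orbits[of mu la n k b a] mu assms by (simp add: is_partition_def)
  then have "mu \<le>\<^sub>R la"
    unfolding refines_def refinement_count_def by (metis card.empty ex_in_conv)
  with mu that show thesis by blast
qed

theorem proposition6p2:
  fixes k n :: nat and la :: "nat list" and x :: "nat \<Rightarrow> real"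
  assumes "is_partition la"
    and "0 < k" and "0 < n"
    and "length la \<le> k"
  shows "expected_poly n k la x =
    (\<Sum>mu | is_partition mu \<and> mu \<le>\<^sub>R la.
        partition_fact la / partition_fact mu
        * (falling_fact k (length la) / real k ^ length mu)
        * (real (refinement_count mu la) / real (refinement_count la la))
        * monomial_sum n mu x)"
proof -
  define M where "M = {mu. is_partition mu \<and> mu \<le>\<^sub>R la}"
  \<comment> \<open>Only these partitions have exponents on [n]; the others carry a zero monomial
    sum and are added back at the end.\<close>
  define M' where "M' = {mu\<in>M. length mu \<le> n}"
  define g where "g b = (\<Prod>j\<in>{1..n}. x j ^ b j / fact (b j))" for b :: "nat \<Rightarrow> nat"
  \<comment> \<open>A finite set of exponents containing every lift and independent of
    \<open>F\<close> and \<open>a\<close>, so that the three sums can be exchanged.\<close>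
  define B where "B = (\<Union>mu\<in>M'. orbit n mu)"
  let ?Fs = "{1..n} \<rightarrow>\<^sub>E {1..k}" and ?O = "orbit k la"
  let ?R = "refinement_count"
  have la: "\<forall>a\<in>set la. 0 < a"
    using assms(1) by (simp add: is_partition_def)
  have finM: "finite M" "finite M'"
    using finite_refinements[of la] by (auto simp: M_def M'_def intro: rev_finite_subset)
  have finB: "finite B"
    using finM by (auto simp: B_def finite_orbit)
  have finF: "finite ?Fs"
    by (auto intro: finite_PiE)
  have "falling_fact k (length la) > 0"
    by (simp add: falling_fact_def)
  \<comment> \<open>If this count were zero, the product in \<open>card_orbit\<close> would vanish,
    although the falling factorial is positive.\<close>
  with card_orbit[OF la assms(4)] have R: "real (?R la la) \<noteq> 0"
    by (metis less_irrefl mult_zero_right)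
  have g_sum: "(\<Sum>b\<in>orbit n mu. g b) = monomial_sum n mu x / partition_fact mu" if "mu \<in> M'" for mu
    using that by (simp only: M'_def g_def mem_Collect_eq monomial_sum_eq_divided_powers)
  have supp: "b j = 0" if "b \<in> B" "j \<notin> {1..n}" for b j
    using that in_orbit_iff[of _ n b] by (auto simp: B_def M'_def M_def is_partition_def)
  have lifts: "lifts {1..n} {1..k} F a = {b\<in>B. F \<in> fiber_maps {1..n} {1..k} b a}"
    if F: "F \<in> ?Fs" and a: "a \<in> ?O" for F a
  proof (intro equalityI subsetI)
    fix b assume b: "b \<in> lifts {1..n} {1..k} F a"
    then have "b \<in> B"
      using lifts_refine[OF la assms(4) F a b] by (auto simp: B_def M'_def M_def)
    with b F show "b \<in> {b\<in>B. F \<in> fiber_maps {1..n} {1..k} b a}"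
      by (auto simp: lifts_def fiber_maps_def)
  qed (use supp in \<open>auto simp: lifts_def fiber_maps_def\<close>)
  have count: "(\<Sum>F\<in>?Fs. if F \<in> fiber_maps {1..n} {1..k} b a then c else 0) =
      real (card (fiber_maps {1..n} {1..k} b a)) * c" for b a and c :: real
  proof -
    have "?Fs \<inter> fiber_maps {1..n} {1..k} b a = fiber_maps {1..n} {1..k} b a"
      by (auto simp: fiber_maps_def)
    with sum.inter_restrict[OF finF, of "\<lambda>_. c" "fiber_maps {1..n} {1..k} b a"]
    show ?thesis by (simp only: sum_constant)
  qed
  have "(\<Sum>F\<in>?Fs. \<Sum>a\<in>?O. \<Sum>b\<in>lifts {1..n} {1..k} F a. g b) =
      (\<Sum>F\<in>?Fs. \<Sum>a\<in>?O. \<Sum>b\<in>B. if F \<in> fiber_maps {1..n} {1..k} b a then g b else 0)"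
    by (rule sum.cong[OF refl], rule sum.cong[OF refl])
      (simp only: lifts sum.inter_filter[OF finB])
  \<comment> \<open>Three adjacent swaps reverse the order of summation.\<close>
  also have "\<dots> = (\<Sum>b\<in>B. \<Sum>a\<in>?O. \<Sum>F\<in>?Fs. if F \<in> fiber_maps {1..n} {1..k} b a then g b else 0)"
    by (subst sum.swap, subst (2) sum.swap, subst sum.swap) (rule refl)
  also have "\<dots> = (\<Sum>b\<in>B. \<Sum>a\<in>?O. real (card (fiber_maps {1..n} {1..k} b a)) * g b)"
    by (simp only: count)
  also have "\<dots> = (\<Sum>mu\<in>M'. \<Sum>b\<in>orbit n mu. \<Sum>a\<in>?O. real (card (fiber_maps {1..n} {1..k} b a)) * g b)"
    unfolding B_def
    by (rule sum.UNION_disjoint) (use finM orbit_unique in \<open>auto simp: finite_orbit M'_def M_def\<close>)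
  also have "\<dots> = (\<Sum>mu\<in>M'. \<Sum>b\<in>orbit n mu. real (card ?O) * (real (k ^ (n - length mu) * ?R mu la) * g b))"
  proof (intro sum.cong refl)
    fix mu b assume "mu \<in> M'" and b: "b \<in> orbit n mu"
    then have mu: "\<forall>a\<in>set mu. 0 < a" "length mu \<le> n"
      by (simp_all add: M'_def M_def is_partition_def)
    show "(\<Sum>a\<in>?O. real (card (fiber_maps {1..n} {1..k} b a)) * g b) =
        real (card ?O) * (real (k ^ (n - length mu) * ?R mu la) * g b)"
      using card_fiber_maps_orbits[OF mu(1) la mu(2) assms(4) b] by simp
  qed
  also have "\<dots> = (\<Sum>mu\<in>M'. real (card ?O) * (real (k ^ (n - length mu) * ?R mu la) *
      (monomial_sum n mu x / partition_fact mu)))"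
    by (rule sum.cong[OF refl]) (simp only: g_sum flip: sum_distrib_left)
  finally have "expected_poly n k la x = partition_fact la / real k ^ n *
      (\<Sum>mu\<in>M'. real (card ?O) * (real (k ^ (n - length mu) * ?R mu la) *
        (monomial_sum n mu x / partition_fact mu)))"
    by (simp only: expected_poly_eq_sum_lifts[OF assms(2,4)] g_def)
  also have "\<dots> = (\<Sum>mu\<in>M'. partition_fact la / partition_fact mu
        * (falling_fact k (length la) / real k ^ length mu)
        * (real (?R mu la) / real (?R la la)) * monomial_sum n mu x)"
    unfolding sum_distrib_left
  proof (intro sum.cong refl)
    fix mu assume "mu \<in> M'"
    \<comment> \<open>The length of \<open>mu\<close> is at most \<open>n\<close>, so the free
      choices cancel against k^n and leave the power \<open>length mu\<close> in the denominator.
      \<open>card_orbit\<close> then replaces the falling factorial by the orbit size times R(la,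
      la).\<close>
    then have "real k ^ n = real k ^ (n - length mu) * real k ^ length mu"
      by (simp add: M'_def flip: power_add)
    then show "partition_fact la / real k ^ n * (real (card ?O) *
        (real (k ^ (n - length mu) * ?R mu la) * (monomial_sum n mu x / partition_fact mu))) =
        partition_fact la / partition_fact mu
        * (falling_fact k (length la) / real k ^ length mu)
        * (real (?R mu la) / real (?R la la)) * monomial_sum n mu x"
      using R assms(2) by (simp add: ac_simps flip: card_orbit[OF la assms(4)])
  qed
  also have "\<dots> = (\<Sum>mu\<in>M. partition_fact la / partition_fact mu
        * (falling_fact k (length la) / real k ^ length mu)
        * (real (?R mu la) / real (?R la la)) * monomial_sum n mu x)"
    by (rule sum.mono_neutral_left) (use finM in \<open>auto simp: M'_def monomial_sum_def\<close>)
  finally show ?thesis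
    by (simp add: M_def)
qed

end
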